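(* Let $G(V,E)$ be a graph. If there exists an independent set of vertices $I\subset V$ such that $\sum_{v\in I} d(v)=\frac{|E|}{2}$, where $d(v)$ is the degree of $v$ in $G$, then $G$ is balanceable.
   Context: All graphs are simple and finite. A 2-coloring of the edges of $K_n$ is a function $\alpha:E(K_n)\to\{R,B\}$. It contains a balanced copy of a graph $G$ if $K_n$ has a (not necessarily induced) subgraph isomorphic to $G$ whose edge set is partitioned into $E_1,E_2$ with $\alpha(e)=R$ for $e\in E_1$, $\alpha(e)=B$ for $e\in E_2$, and $\big||E_1|-|E_2|\big|\le 1$. A graph $G$ is balanceable if there is an $n_0$ such that for every $n\ge n_0$ there exists an integer $m$ with $0\le m<\lfloor \frac12\binom n2\rfloor$ such that every 2-coloring $\alpha$ of $E(K_n)$ with $|\alpha^{-1}(R)|>m$ and $|\alpha^{-1}(B)|>m$ contains a balanced copy of $G$. *)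

theory Defs
  imports Complex_Main "HOL-Library.Ramsey"
begin

text \<open>
  A graph is given by its vertex set \<open>V\<close> and its edge set \<open>E\<close>, whose elements are
  two-element subsets of \<open>V\<close>.  The complete graph \<open>K\<^sub>n\<close> has the vertices \<open>0, \<dots>, n - 1\<close>.
\<close>

definition simple_graph :: "'a set \<Rightarrow> 'a set set \<Rightarrow> bool" where
  "simple_graph V E \<longleftrightarrow> finite V \<and> E \<subseteq> [V]\<^bsup>2\<^esup>"

definition vertex_degree :: "'a set set \<Rightarrow> 'a \<Rightarrow> nat" where
  "vertex_degree E v = card {e \<in> E. v \<in> e}"

definition graph_isomorphic :: "'a set \<Rightarrow> 'a set set \<Rightarrow> 'b set \<Rightarrow> 'b set set \<Rightarrow> bool" where
  "graph_isomorphic V E W F \<longleftrightarrow>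
     (\<exists>f. bij_betw f V W \<and> (\<forall>x\<in>V. \<forall>y\<in>V. {x, y} \<in> E \<longleftrightarrow> {f x, f y} \<in> F))"

definition subgraph :: "'a set \<Rightarrow> 'a set set \<Rightarrow> 'a set \<Rightarrow> 'a set set \<Rightarrow> bool" where
  "subgraph W F V E \<longleftrightarrow> simple_graph W F \<and> W \<subseteq> V \<and> F \<subseteq> E"

datatype colour = Red | Blue

abbreviation K_verts :: "nat \<Rightarrow> nat set" where
  "K_verts n \<equiv> {..<n}"

abbreviation K_edges :: "nat \<Rightarrow> nat set set" where
  "K_edges n \<equiv> [K_verts n]\<^bsup>2\<^esup>"

text \<open>
  A 2-coloring of \<open>E(K\<^sub>n)\<close> is a function \<open>\<alpha>\<close> of type \<^typ>\<open>nat set \<Rightarrow> colour\<close>, of which only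
  the values on \<open>K_edges n\<close> are ever used.
\<close>

definition colour_class :: "nat \<Rightarrow> (nat set \<Rightarrow> colour) \<Rightarrow> colour \<Rightarrow> nat set set" where
  "colour_class n \<alpha> c = {e \<in> K_edges n. \<alpha> e = c}"

definition contains_balanced_copy ::
    "nat \<Rightarrow> (nat set \<Rightarrow> colour) \<Rightarrow> 'a set \<Rightarrow> 'a set set \<Rightarrow> bool" where
  "contains_balanced_copy n \<alpha> V E \<longleftrightarrow>
     (\<exists>W F E1 E2. subgraph W F (K_verts n) (K_edges n) \<and> graph_isomorphic V E W F \<and>
        F = E1 \<union> E2 \<and> E1 \<inter> E2 = {} \<and>
        (\<forall>e\<in>E1. \<alpha> e = Red) \<and> (\<forall>e\<in>E2. \<alpha> e = Blue) \<and>
        \<bar>int (card E1) - int (card E2)\<bar> \<le> 1)"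

definition balanceable :: "'a set \<Rightarrow> 'a set set \<Rightarrow> bool" where
  "balanceable V E \<longleftrightarrow>
     (\<exists>n0::nat. \<forall>n\<ge>n0. \<exists>m::nat. int m < \<lfloor>1 / 2 * real (n choose 2)\<rfloor> \<and>
        (\<forall>\<alpha> :: nat set \<Rightarrow> colour.
           card (colour_class n \<alpha> Red) > m \<and> card (colour_class n \<alpha> Blue) > m \<longrightarrow>
           contains_balanced_copy n \<alpha> V E))"

end

theory Submission
  imports Defs
begin

text \<open>
  Take \<open>m = \<lfloor>(n choose 2) / 2\<rfloor> - 1\<close>, so that only colourings with at least about half of the
  edges in each colour matter.  It suffices to find a large monochromatic clique \<open>A\<close> and a large
  set \<open>B\<close> such that all \<open>A\<close>-\<open>B\<close> edges have the opposite colour: embedding \<open>I\<close> into \<open>B\<close> and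
  \<open>V - I\<close> into \<open>A\<close> gives the edges meeting \<open>I\<close>, of which there are \<open>card E div 2\<close>, one colour and
  the others the other colour.

  A dense colour class contains a large complete bipartite graph (Kovari-Sos-Turan).  Apply Ramsey's
  theorem to one of its sides: either the desired pattern appears, or there is a large clique in that
  same colour.  Hence without the pattern there are large cliques in both colours.  They share at
  most one vertex, and by pigeonhole the edges between them contain a large monochromatic complete
  bipartite graph; whatever its colour is, it forms the pattern with the clique of the other colour.
\<close>

section \<open>Bicliques from density and from pigeonhole\<close>

text \<open>Count the pairs of a high-degree vertex and an \<open>s\<close>-set of its neighbours.
  Linearly many such vertices each see on the order of \<open>card V ^ s\<close> sets, so some set
  is seen by \<open>t\<close> of them.\<close>

lemma dense_contains_biclique:
  "\<exists>n0. \<forall>(V::'a set) F. finite V \<and> n0 \<le> card V \<and> F \<subseteq> [V]\<^bsup>2\<^esup> \<and> (card V)\<^sup>2 \<le> 8 * card F \<longrightarrow>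
     (\<exists>A B. A \<subseteq> V \<and> B \<subseteq> V \<and> card A = s \<and> card B = t \<and> (\<forall>a\<in>A. \<forall>b\<in>B. {a, b} \<in> F))"
\<comment> \<open>The summand \<open>16 * s\<close> gives each vertex of \<open>H\<close> at least
  \<open>s\<close> neighbours, as the binomial lower bound requires. The other product contradicts
  the upper bound on \<open>card H\<close>, and \<open>+ 1\<close> makes the inequality
  strict.\<close>
proof (intro exI[of _ "16 * s + 16 * t * (16 * s) ^ s + 1"] allI impI)
  fix V :: "'a set" and F
  let ?n = "card V"
  assume asm: "finite V \<and> 16 * s + 16 * t * (16 * s) ^ s + 1 \<le> ?n \<and> F \<subseteq> [V]\<^bsup>2\<^esup> \<and> ?n\<^sup>2 \<le> 8 * card F"
  then have fin: "finite V" and F: "F \<subseteq> [V]\<^bsup>2\<^esup>" and dens: "?n\<^sup>2 \<le> 8 * card F"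
    and large: "16 * s + 16 * t * (16 * s) ^ s < ?n" by auto
  define N where "N v = {w \<in> V. {v, w} \<in> F}" for v
  define H where "H = {v \<in> V. ?n \<le> 16 * card (N v)}"
  have finN: "finite (N v)" and NV: "N v \<subseteq> V" and finH: "finite H" and HV: "H \<subseteq> V" for v
    using fin by (auto simp: N_def H_def)
  have "F \<subseteq> (\<Union>v\<in>V. (\<lambda>w. {v, w}) ` N v)"
  proof
    fix e assume e: "e \<in> F"
    then obtain x y where "e = {x, y}" "x \<in> V" "y \<in> V"
      using F unfolding nsets_2_eq by blast
    with e show "e \<in> (\<Union>v\<in>V. (\<lambda>w. {v, w}) ` N v)" by (auto simp: N_def)
  qed
  then have "card F \<le> card (\<Union>v\<in>V. (\<lambda>w. {v, w}) ` N v)"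
    by (intro card_mono) (auto simp: fin finN)
  also have "\<dots> \<le> (\<Sum>v\<in>V. card ((\<lambda>w. {v, w}) ` N v))" by (rule card_UN_le[OF fin])
  also have "\<dots> \<le> (\<Sum>v\<in>V. card (N v))" by (intro sum_mono card_image_le finN)
  finally have "16 * card F \<le> (\<Sum>v\<in>V. 16 * card (N v))" by (simp add: sum_distrib_left[symmetric])
  \<comment> \<open>The degrees sum to at least an eighth of the square of \<open>card V\<close>.
    Vertices outside \<open>H\<close> account for at most half of that, and a vertex of
    \<open>H\<close> for at most \<open>card V\<close>, so \<open>H\<close> contains at least a
    sixteenth of all vertices.\<close>
  also have "\<dots> \<le> (\<Sum>v\<in>V. (if v \<in> H then 16 * ?n else 0) + ?n)"
  proof (intro sum_mono)
    fix v assume "v \<in> V"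
    then show "16 * card (N v) \<le> (if v \<in> H then 16 * ?n else 0) + ?n"
      using card_mono[OF fin NV[of v]] by (auto simp: H_def)
  qed
  also have "\<dots> = 16 * ?n * card H + ?n * ?n"
    using HV fin by (simp add: sum.distrib sum.If_cases Int_absorb1)
  finally have "?n * ?n \<le> ?n * (16 * card H)"
    using dens unfolding power2_eq_square mult.left_commute[of ?n 16] by linarith
  then have cardH: "?n \<le> 16 * card H" using large by simp

  let ?S = "{S. S \<subseteq> V \<and> card S = s}"
  have finS: "finite ?S" using fin by simp
  have "\<exists>S\<in>?S. t \<le> card {v \<in> H. S \<subseteq> N v}"
  proof (rule ccontr)
    assume neg: "\<not> ?thesis"
    then have less: "card {v \<in> H. S \<subseteq> N v} \<le> t" if "S \<in> ?S" for S
      using neg that by (auto simp: not_le intro: less_imp_le)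
    have "(\<Sum>v\<in>H. card (N v) choose s) = (\<Sum>v\<in>H. card {S \<in> ?S. S \<subseteq> N v})"
    proof (intro sum.cong refl)
      fix v
      have "{S \<in> ?S. S \<subseteq> N v} = {S. S \<subseteq> N v \<and> card S = s}" using NV by auto
      then show "card (N v) choose s = card {S \<in> ?S. S \<subseteq> N v}"
        using n_subsets[OF finN] by simp
    qed
    also have "\<dots> = (\<Sum>S\<in>?S. card {v \<in> H. S \<subseteq> N v})"
      by (rule sum_multicount_gen[OF finH finS]) simp
    also have "\<dots> \<le> (\<Sum>S\<in>?S. t)" by (intro sum_mono less)
    also have "\<dots> = (?n choose s) * t" using n_subsets[OF fin] by simp
    also have "\<dots> \<le> ?n ^ s * t" using large by (intro mult_right_mono binomial_le_pow) auto
    finally have upper: "(\<Sum>v\<in>H. card (N v) choose s) \<le> ?n ^ s * t" .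
    have lower: "(real ?n / (16 * s)) ^ s \<le> real (card (N v) choose s)" if "v \<in> H" for v
    proof -
      have n: "?n \<le> 16 * card (N v)" using that by (simp add: H_def)
      have "(real ?n / (16 * s)) ^ s \<le> (real (card (N v)) / s) ^ s"
        using n divide_right_mono[of "real ?n / 16" "real (card (N v))" "real s"]
        by (intro power_mono) auto
      also have "\<dots> \<le> real (card (N v) choose s)"
        using n large by (intro binomial_ge_n_over_k_pow_k) auto
      finally show ?thesis .
    qed
    have "real (card H) * (real ?n / (16 * s)) ^ s \<le> (\<Sum>v\<in>H. real (card (N v) choose s))"
      using sum_mono[of H "\<lambda>_. (real ?n / (16 * s)) ^ s", OF lower] by simp
    also have "\<dots> \<le> real (?n ^ s * t)" using upper by (metis of_nat_mono of_nat_sum)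
    finally have "real (card H) * ?n ^ s \<le> real ?n ^ s * t * (16 * s) ^ s"
      \<comment> \<open>For \<open>s = 0\<close> the quotient divides by zero, but its zeroth power
        is still 1.\<close>
      by (cases "s = 0") (auto simp: power_divide field_simps power_mult_distrib)
    then have "real ?n ^ s * card H \<le> real ?n ^ s * (t * (16 * s) ^ s)" by (simp add: ac_simps)
    moreover have "real ?n ^ s > 0" using large by simp
    ultimately have "real (card H) \<le> real (t * (16 * s) ^ s)" by simp
    then have "card H \<le> t * (16 * s) ^ s" by (simp only: of_nat_le_iff)
    with cardH large show False by simp
  qed
  then obtain S where S: "S \<subseteq> V" "card S = s" and t: "t \<le> card {v \<in> H. S \<subseteq> N v}" by blast
  obtain T where T: "T \<subseteq> {v \<in> H. S \<subseteq> N v}" "card T = t" using obtain_subset_with_card_n[OF t] .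
  have "\<forall>a\<in>S. \<forall>b\<in>T. {a, b} \<in> F" using T by (fastforce simp: N_def insert_commute)
  with S T HV show "\<exists>A B. A \<subseteq> V \<and> B \<subseteq> V \<and> card A = s \<and> card B = t \<and> (\<forall>a\<in>A. \<forall>b\<in>B. {a, b} \<in> F)"
    by blast
qed

text \<open>Fix \<open>2 * k\<close> vertices of \<open>X\<close>. Each vertex of \<open>Y\<close>
  has one of \<open>2 ^ (2 * k)\<close> possible red neighbourhoods among them, so \<open>k\<close>
  vertices of \<open>Y\<close> share one, say \<open>P\<close>. Either \<open>P\<close> or its
  complement has \<open>k\<close> elements, which gives a red or a blue biclique.\<close>

lemma bipartite_ramsey:
  fixes \<alpha> :: "'a set \<Rightarrow> colour"
  assumes "finite X" "finite Y" "2 * k \<le> card X" "2 ^ (2 * k) * k \<le> card Y"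
  obtains A B c where "A \<subseteq> X" "B \<subseteq> Y" "card A = k" "card B = k" "\<forall>a\<in>A. \<forall>b\<in>B. \<alpha> {a, b} = c"
proof -
  obtain X0 where X0: "X0 \<subseteq> X" "card X0 = 2 * k" using obtain_subset_with_card_n[OF assms(3)] .
  then have finX0: "finite X0" using assms(1) finite_subset by blast
  define p where "p y = {x \<in> X0. \<alpha> {x, y} = Red}" for y
  have "\<exists>P\<in>Pow X0. k \<le> card {y \<in> Y. p y = P}"
  proof (cases "k = 0")
    case True
    then show ?thesis by auto
  next
    case False
    show ?thesis
    proof (rule ccontr)
      assume neg: "\<not> ?thesis"
      then have less: "card {y \<in> Y. p y = P} < k" if "P \<in> Pow X0" for P using neg that by (auto simp: not_le)
      have "p y \<in> Pow X0" for y by (auto simp: p_def)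
      then have "Y = (\<Union>P\<in>Pow X0. {y \<in> Y. p y = P})" by blast
      then have "card Y \<le> (\<Sum>P\<in>Pow X0. card {y \<in> Y. p y = P})"
        using card_UN_le[of "Pow X0" "\<lambda>P. {y \<in> Y. p y = P}"] finX0 by simp
      also have "\<dots> < (\<Sum>P\<in>Pow X0. k)" using finX0 less by (intro sum_strict_mono) auto
      also have "\<dots> = 2 ^ (2 * k) * k" using X0 by (simp add: card_Pow finX0)
      finally show False using assms(4) by simp
    qed
  qed
  then obtain P where P: "P \<subseteq> X0" "k \<le> card {y \<in> Y. p y = P}" by blast
  obtain B where B: "B \<subseteq> {y \<in> Y. p y = P}" "card B = k" using obtain_subset_with_card_n[OF P(2)] .
  have "card P + card (X0 - P) = 2 * k"
    using X0 P finX0 card_mono[OF finX0 P(1)] by (simp add: card_Diff_subset finite_subset)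
  then consider "k \<le> card P" | "k \<le> card (X0 - P)" by linarith
  then show thesis
  proof cases
    case 1
    obtain A where "A \<subseteq> P" "card A = k" using obtain_subset_with_card_n[OF 1] .
    with B P X0 show thesis by (intro that[of A B Red]) (auto simp: p_def)
  next
    case 2
    obtain A where A: "A \<subseteq> X0 - P" "card A = k" using obtain_subset_with_card_n[OF 2] .
    have "\<alpha> {a, b} = Blue" if "a \<in> A" "b \<in> B" for a b
      using A B that by (cases "\<alpha> {a, b}") (auto simp: p_def)
    with A B X0 show thesis by (intro that[of A B Blue]) auto
  qed
qed

section \<open>The unavoidable pattern\<close>

text \<open>Edges inside \<open>B\<close> may have any colours, because only an independent set will
  be embedded there. The pattern is symmetric in the two colours.\<close>

definition clique_with_opposite_cut :: "nat \<Rightarrow> (nat set \<Rightarrow> colour) \<Rightarrow> nat \<Rightarrow> bool" where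
  "clique_with_opposite_cut n \<alpha> k \<longleftrightarrow>
     (\<exists>A B c d. c \<noteq> d \<and> A \<subseteq> {..<n} \<and> B \<subseteq> {..<n} \<and> A \<inter> B = {} \<and> card A = k \<and> card B = k \<and>
        clique A {e. \<alpha> e = c} \<and> (\<forall>a\<in>A. \<forall>b\<in>B. \<alpha> {a, b} = d))"

lemma clique_with_opposite_cutI:
  assumes "clique A {e. \<alpha> e = c}" "\<forall>a\<in>A. \<forall>b\<in>B. \<alpha> {a, b} = d" "c \<noteq> d"
    "A \<subseteq> {..<n}" "B \<subseteq> {..<n}" "A \<inter> B = {}" "card A = k" "card B = k"
  shows "clique_with_opposite_cut n \<alpha> k"
  unfolding clique_with_opposite_cut_def using assms by blast

lemma dense_colour_clique:
  "\<exists>n0. \<forall>n\<ge>n0. \<forall>\<alpha> c. n\<^sup>2 \<le> 8 * card (colour_class n \<alpha> c) \<longrightarrow>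
     clique_with_opposite_cut n \<alpha> k \<or>
     (\<exists>A. A \<subseteq> {..<n} \<and> card A = T \<and> clique A {e. \<alpha> e = c})"
proof -
  \<comment> \<open>Only one side of the biclique has to be of Ramsey size; the other side becomes
    the \<open>B\<close> of the pattern.\<close>
  obtain r where r: "\<And>(V::nat set) E. finite V \<and> card V \<ge> r \<Longrightarrow>
      (\<exists>R\<subseteq>V. card R = T \<and> clique R E \<or> card R = k \<and> indep R E)"
    using ramsey2[of T k, where 'a = nat] by blast
  obtain n0 where n0: "\<And>(V::nat set) F.
      finite V \<and> n0 \<le> card V \<and> F \<subseteq> [V]\<^bsup>2\<^esup> \<and> (card V)\<^sup>2 \<le> 8 * card F \<Longrightarrow>
      \<exists>A B. A \<subseteq> V \<and> B \<subseteq> V \<and> card A = r \<and> card B = k \<and> (\<forall>a\<in>A. \<forall>b\<in>B. {a, b} \<in> F)"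
    using dense_contains_biclique[of r k, where 'a = nat] by blast
  show ?thesis
  proof (intro exI[of _ n0] allI impI)
    fix n \<alpha> c assume n: "n0 \<le> n" and dens: "n\<^sup>2 \<le> 8 * card (colour_class n \<alpha> c)"
    obtain X B where XB: "X \<subseteq> {..<n}" "B \<subseteq> {..<n}" "card X = r" "card B = k"
        "\<forall>a\<in>X. \<forall>b\<in>B. {a, b} \<in> colour_class n \<alpha> c"
      using n0[of "{..<n}" "colour_class n \<alpha> c"] n dens by (auto simp: colour_class_def)
    have "finite X" using XB by (auto intro: finite_subset)
    then obtain R where R: "R \<subseteq> X"
        "card R = T \<and> clique R {e. \<alpha> e = c} \<or> card R = k \<and> indep R {e. \<alpha> e = c}"
      using r[of X "{e. \<alpha> e = c}"] XB(3) by auto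
    define d where "d = (case c of Red \<Rightarrow> Blue | Blue \<Rightarrow> Red)"
    have d: "d \<noteq> c" "x \<noteq> c \<longleftrightarrow> x = d" for x by (cases c; cases x; simp add: d_def)+
    from R(2) show "clique_with_opposite_cut n \<alpha> k \<or>
        (\<exists>A. A \<subseteq> {..<n} \<and> card A = T \<and> clique A {e. \<alpha> e = c})"
    proof
      assume R': "card R = k \<and> indep R {e. \<alpha> e = c}"
      then have "clique R {e. \<alpha> e = d}" by (auto simp: indep_def clique_def d)
      \<comment> \<open>A common vertex \<open>a\<close> would put the singleton
        \<open>{a, a}\<close> into a colour class, whose elements have two vertices.\<close>
      moreover have "X \<inter> B = {}"
        using XB(5) by (force simp: colour_class_def nsets_def)
      moreover have "\<forall>a\<in>R. \<forall>b\<in>B. \<alpha> {a, b} = c"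
        using XB(5) R(1) by (auto simp: colour_class_def)
      ultimately have "clique_with_opposite_cut n \<alpha> k"
        using R R' XB d(1) by (intro clique_with_opposite_cutI[of R \<alpha> d B c]) auto
      then show ?thesis ..
    qed (use R XB in blast)
  qed
qed

lemma dense_colours_clique_with_opposite_cut:
  "\<exists>n0. \<forall>n\<ge>n0. \<forall>\<alpha>. (\<forall>c. n\<^sup>2 \<le> 8 * card (colour_class n \<alpha> c)) \<longrightarrow> clique_with_opposite_cut n \<alpha> k"
proof -
  \<comment> \<open>Large enough for either side of \<open>bipartite_ramsey\<close>, with one spare
    vertex because the two cliques may share one.\<close>
  define T where "T = 2 * k + 2 ^ (2 * k) * k + 1"
  obtain n0 where n0: "\<And>n \<alpha> c. n0 \<le> n \<Longrightarrow> n\<^sup>2 \<le> 8 * card (colour_class n \<alpha> c) \<Longrightarrow>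
     clique_with_opposite_cut n \<alpha> k \<or> (\<exists>A. A \<subseteq> {..<n} \<and> card A = T \<and> clique A {e. \<alpha> e = c})"
    using dense_colour_clique[of k T] by metis
  show ?thesis
  proof (intro exI[of _ n0] allI impI)
    fix n \<alpha> assume n: "n0 \<le> n" and dens: "\<forall>c. n\<^sup>2 \<le> 8 * card (colour_class n \<alpha> c)"
    show "clique_with_opposite_cut n \<alpha> k"
    proof (rule ccontr)
      assume no: "\<not> ?thesis"
      obtain X where X: "X \<subseteq> {..<n}" "card X = T" "clique X {e. \<alpha> e = Red}"
        using n0[OF n] dens no by blast
      obtain Y where Y: "Y \<subseteq> {..<n}" "card Y = T" "clique Y {e. \<alpha> e = Blue}"
        using n0[OF n] dens no by blast
      have fin: "finite X" "finite Y" using X Y by (auto intro: finite_subset)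
      \<comment> \<open>Two distinct common vertices would span an edge that is both red and
        blue.\<close>
      have "a = b" if "a \<in> X \<inter> Y" "b \<in> X \<inter> Y" for a b
        using X(3) Y(3) that by (force simp: clique_def)
      then have "card (X \<inter> Y) \<le> 1" using fin by (simp add: card_le_Suc0_iff_eq)
      then have "T - 1 \<le> card (X - Y)"
        using X fin by (simp add: card_Diff_subset_Int)
      then obtain A B c where AB: "A \<subseteq> X - Y" "B \<subseteq> Y" "card A = k" "card B = k"
          "\<forall>a\<in>A. \<forall>b\<in>B. \<alpha> {a, b} = c"
        using bipartite_ramsey[of "X - Y" Y k \<alpha>] fin Y by (auto simp: T_def)
      have cl: "clique A {e. \<alpha> e = Red}" "clique B {e. \<alpha> e = Blue}"
        using AB(1,2) X(3) Y(3) unfolding clique_def by blast+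
      have "clique_with_opposite_cut n \<alpha> k"
      \<comment> \<open>The cut is paired with the clique of the opposite colour, so in the red case
        \<open>A\<close> and \<open>B\<close> swap roles.\<close>
      proof (cases c)
        case Red
        then have "\<forall>b\<in>B. \<forall>a\<in>A. \<alpha> {b, a} = Red" using AB(5) by (metis insert_commute)
        then show ?thesis using AB X(1) Y(1)
          by (intro clique_with_opposite_cutI[OF cl(2), of A Red]) auto
      next
        case Blue
        then show ?thesis using AB X(1) Y(1)
          by (intro clique_with_opposite_cutI[OF cl(1), of B Blue]) auto
      qed
      with no show False by blast
    qed
  qed
qed

section \<open>Embedding the graph into the pattern\<close>

text \<open>No edge has both ends in \<open>I\<close>, so the edge sets at distinct vertices of
  \<open>I\<close> are disjoint and the degree sum counts no edge twice.\<close>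

lemma card_edges_meeting_indep:
  assumes "finite E" "E \<subseteq> [V]\<^bsup>2\<^esup>" "finite I" "indep I E"
  shows "card {e \<in> E. e \<inter> I \<noteq> {}} = (\<Sum>v\<in>I. vertex_degree E v)"
proof -
  have "{e \<in> E. e \<inter> I \<noteq> {}} = (\<Union>v\<in>I. {e \<in> E. v \<in> e})" by auto
  moreover have "{e \<in> E. v \<in> e} \<inter> {e \<in> E. w \<in> e} = {}" if "v \<in> I" "w \<in> I" "v \<noteq> w" for v w
  proof -
    have "e = {v, w}" if "e \<in> E" "v \<in> e" "w \<in> e" for e
      using that assms(2) \<open>v \<noteq> w\<close> by (fastforce simp: nsets_2_eq)
    then show ?thesis using assms(4) that by (auto simp: indep_def)
  qed
  ultimately show ?thesis
    using assms by (simp add: card_UN_disjoint vertex_degree_def)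
qed

text \<open>Map \<open>I\<close> into \<open>B\<close> and the rest into \<open>A\<close>; each has
  room for all of \<open>V\<close>. By independence an edge meeting \<open>I\<close> crosses the cut
  and gets colour \<open>d\<close>, while every other edge lands inside \<open>A\<close> and gets
  colour \<open>c\<close>. The degree condition makes the two numbers equal.\<close>

lemma clique_with_opposite_cut_balanced_copy:
  fixes V :: "'a set"
  assumes G: "simple_graph V E" and I: "I \<subseteq> V" "indep I E"
    and half: "2 * (\<Sum>v\<in>I. vertex_degree E v) = card E"
    and pat: "clique_with_opposite_cut n \<alpha> (card V)"
  shows "contains_balanced_copy n \<alpha> V E"
proof -
  obtain A B c d where cd: "c \<noteq> d" and AB: "A \<subseteq> {..<n}" "B \<subseteq> {..<n}" "A \<inter> B = {}"
      "card A = card V" "card B = card V"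
    and clA: "clique A {e. \<alpha> e = c}" and cut: "\<forall>a\<in>A. \<forall>b\<in>B. \<alpha> {a, b} = d"
    using pat unfolding clique_with_opposite_cut_def by blast
  have finV: "finite V" and EV: "E \<subseteq> [V]\<^bsup>2\<^esup>" using G by (auto simp: simple_graph_def)
  have finE: "finite E" using finV EV by (meson finite_imp_finite_nsets finite_subset)
  have finI: "finite I" using I finV finite_subset by blast
  have finAB: "finite A" "finite B" using AB by (auto intro: finite_subset)
  obtain f where f: "f ` V \<subseteq> A" "inj_on f V"
    using card_le_inj[OF finV finAB(1)] AB(4) by (metis order_refl)
  obtain g where g: "g ` V \<subseteq> B" "inj_on g V"
    using card_le_inj[OF finV finAB(2)] AB(5) by (metis order_refl)
  define h where "h v = (if v \<in> I then g v else f v)" for v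
  have injh: "inj_on h V"
  proof (rule inj_onI)
    fix x y assume xy: "x \<in> V" "y \<in> V" "h x = h y"
    have "f x \<in> A" "f y \<in> A" "g x \<in> B" "g y \<in> B" using xy f(1) g(1) by auto
    then have "x \<in> I \<longleftrightarrow> y \<in> I" using AB(3) xy(3) unfolding h_def by (metis disjoint_iff)
    then show "x = y" using xy inj_onD[OF f(2)] inj_onD[OF g(2)] unfolding h_def by metis
  qed
  have hV: "h ` V \<subseteq> {..<n}" using f(1) g(1) AB(1,2) unfolding h_def by (auto; blast)
  have EPow: "E \<subseteq> Pow V" using EV by (auto simp: nsets_def)
  have injE: "inj_on ((`) h) E" by (rule inj_on_subset[OF inj_on_image_Pow[OF injh] EPow])
  define M where "M = {e \<in> E. e \<inter> I \<noteq> {}}"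
  have ME: "M \<subseteq> E" by (auto simp: M_def)
  have cardM: "2 * card M = card E"
    using card_edges_meeting_indep[OF finE EV finI I(2)] half by (simp add: M_def)
  then have cardEM: "card (E - M) = card M"
    using ME finE by (simp add: card_Diff_subset finite_subset)
  have colM: "\<alpha> (h ` e) = d" if eM: "e \<in> M" for e
  proof -
    obtain x y where e: "e = {x, y}" "x \<in> I" "y \<in> V" "x \<noteq> y"
    proof -
      have "e \<in> [V]\<^bsup>2\<^esup>" using eM EV by (auto simp: M_def)
      then obtain u v where "e = {u, v}" "u \<in> V" "v \<in> V" "u \<noteq> v" by (rule nsets2_E)
      moreover have "e \<inter> I \<noteq> {}" using eM by (simp add: M_def)
      ultimately show thesis using that[of u v] that[of v u] by (auto simp: insert_commute)
    qed
    then have "y \<notin> I" using eM I(2) by (auto simp: M_def indep_def)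
    then have "g x \<in> B" "f y \<in> A" "h ` e = {f y, g x}" using e f g I by (auto simp: h_def)
    then show ?thesis using cut by simp
  qed
  have colEM: "\<alpha> (h ` e) = c" if eM: "e \<in> E - M" for e
  proof -
    obtain x y where e: "e = {x, y}" "x \<in> V" "y \<in> V" "x \<noteq> y"
      using eM EV by (blast elim: nsets2_E)
    then have "x \<notin> I" "y \<notin> I" using eM by (auto simp: M_def)
    then have "f x \<in> A" "f y \<in> A" "h ` e = {f x, f y}" "f x \<noteq> f y"
      using e f by (auto simp: h_def inj_on_def)
    then show ?thesis using clA by (auto simp: clique_def)
  qed
  \<comment> \<open>Indexing the two halves by colour yields \<open>E1\<close> and \<open>E2\<close>
    as \<open>C Red\<close> and \<open>C Blue\<close>, whichever of \<open>c\<close> and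
    \<open>d\<close> is red.\<close>
  define C where "C x = (if x = c then (`) h ` (E - M) else (`) h ` M)" for x
  have "(\<Union>x. C x) = (`) h ` E" using ME cd by (auto simp: C_def)
  moreover have "(\<Union>x. C x) = C Red \<union> C Blue"
    by (auto intro: colour.exhaust) (metis colour.exhaust)
  ultimately have CU: "(`) h ` E = C Red \<union> C Blue" by simp
  have colC: "\<forall>e\<in>C x. \<alpha> e = x" for x
    using colM colEM cd by (cases x; cases c; cases d; auto simp: C_def)
  have cardC: "card (C x) = card M" for x
    using cardEM injE ME by (auto simp: C_def card_image inj_on_subset[OF injE])
  have sub: "subgraph (h ` V) ((`) h ` E) {..<n} (K_edges n)"
  proof -
    have "(`) h ` E \<subseteq> [h ` V]\<^bsup>2\<^esup>"
      using EV injh by (auto simp: nsets_def card_image inj_on_subset)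
    moreover have "[h ` V]\<^bsup>2\<^esup> \<subseteq> K_edges n" by (rule nsets_mono[OF hV])
    ultimately show ?thesis using finV hV by (auto simp: subgraph_def simple_graph_def)
  qed
  have iso: "graph_isomorphic V E (h ` V) ((`) h ` E)"
    unfolding graph_isomorphic_def
  proof (intro exI[of _ h] conjI ballI)
    fix x y assume "x \<in> V" "y \<in> V"
    then show "{x, y} \<in> E \<longleftrightarrow> {h x, h y} \<in> (`) h ` E"
      using inj_on_image_mem_iff[OF inj_on_image_Pow[OF injh], of "{x, y}" E] EPow by simp
  qed (use injh in \<open>simp add: bij_betw_def\<close>)
  have "C Red \<inter> C Blue = {}" using colC[of Red] colC[of Blue] by fastforce
  moreover have "\<bar>int (card (C Red)) - int (card (C Blue))\<bar> \<le> 1" by (simp add: cardC)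
  ultimately have "subgraph (h ` V) ((`) h ` E) {..<n} (K_edges n) \<and>
      graph_isomorphic V E (h ` V) ((`) h ` E) \<and> (`) h ` E = C Red \<union> C Blue \<and>
      C Red \<inter> C Blue = {} \<and> (\<forall>e\<in>C Red. \<alpha> e = Red) \<and> (\<forall>e\<in>C Blue. \<alpha> e = Blue) \<and>
      \<bar>int (card (C Red)) - int (card (C Blue))\<bar> \<le> 1"
    using CU colC sub iso by (intro conjI)
  then show ?thesis unfolding contains_balanced_copy_def by (intro exI)
qed

theorem proposition3:
  fixes V :: "'a set" and E :: "'a set set"
  assumes "simple_graph V E"
    and "\<exists>I. I \<subseteq> V \<and> indep I E \<and> real (\<Sum>v\<in>I. vertex_degree E v) = real (card E) / 2"
  shows "balanceable V E"
proof -
  obtain I where I: "I \<subseteq> V" "indep I E" "real (\<Sum>v\<in>I. vertex_degree E v) = real (card E) / 2"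
    using assms(2) by blast
  then have half: "2 * (\<Sum>v\<in>I. vertex_degree E v) = card E" by linarith
  obtain n0 where n0: "\<And>n \<alpha>. n0 \<le> n \<Longrightarrow> \<forall>c. n\<^sup>2 \<le> 8 * card (colour_class n \<alpha> c) \<Longrightarrow>
      clique_with_opposite_cut n \<alpha> (card V)"
    using dense_colours_clique_with_opposite_cut by metis
  show ?thesis unfolding balanceable_def
  proof (rule exI[of _ "max n0 4"], intro allI impI)
    fix n assume "max n0 4 \<le> n"
    then have n: "n0 \<le> n" "4 \<le> n" by auto
    have choose: "2 * (n choose 2) = n * (n - 1)" by (cases n) (auto simp: choose_two)
    define q where "q = (n choose 2) div 2"
    have q: "\<lfloor>1 / 2 * real (n choose 2)\<rfloor> = int q"
      unfolding q_def using floor_divide_of_nat_eq[of "n choose 2" 2, where 'a = real] by simp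
    have "4 * 4 \<le> n * n" using n by (intro mult_mono) auto
    have "4 * n \<le> n * n" using n by simp
    have "n * n - n = 2 * (n choose 2)" using choose by (simp add: diff_mult_distrib2)
    \<comment> \<open>Half of all edges is about a quarter of the square of \<open>n\<close>, twice
      the density required. This slack absorbs the linear term and the rounding once
      \<open>n\<close> is at least 4.\<close>
    then have q8: "n * n \<le> 8 * q" "0 < q"
      using \<open>4 * 4 \<le> n * n\<close> \<open>4 * n \<le> n * n\<close> n unfolding q_def by linarith+
    show "\<exists>m. int m < \<lfloor>1 / 2 * real (n choose 2)\<rfloor> \<and> (\<forall>\<alpha>. m < card (colour_class n \<alpha> Red) \<and>
        m < card (colour_class n \<alpha> Blue) \<longrightarrow> contains_balanced_copy n \<alpha> V E)"
    \<comment> \<open>The largest admissible \<open>m\<close>: exceeding it means having at least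
      \<open>q\<close> edges. The subtraction does not truncate, since \<open>q\<close> is
      positive.\<close>
    proof (intro exI[of _ "q - 1"] conjI allI impI)
      show "int (q - 1) < \<lfloor>1 / 2 * real (n choose 2)\<rfloor>" using q q8 by simp
    next
      fix \<alpha> assume large: "q - 1 < card (colour_class n \<alpha> Red) \<and> q - 1 < card (colour_class n \<alpha> Blue)"
      have "n\<^sup>2 \<le> 8 * card (colour_class n \<alpha> c)" for c
        using large q8 by (cases c) (auto simp: power2_eq_square)
      then show "contains_balanced_copy n \<alpha> V E"
        using clique_with_opposite_cut_balanced_copy[OF assms(1) I(1,2) half] n0[OF n(1)] by blast
    qed
  qed
qed

end
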